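(* Let $n=m=M=1$. Suppose there exists $\Theta\in\mathbb{R}$ satisfying $R_{xr}^{N-}\Theta=(R_{xr}^{N-}\Theta)^\top$ such that $$\begin{bmatrix}R_{xr}^{N-}\Theta&(R_{xr}^{N+}-c^l)\Theta\\ \Theta^\top(R_{xr}^{N+}-c^l)^\top&R_{xr}^{N-}\Theta\end{bmatrix}\succ0\quad\text{and}\quad\begin{bmatrix}R_{xr}^{N-}\Theta&(R_{xr}^{N+}-c^u)\Theta\\ \Theta^\top(R_{xr}^{N+}-c^u)^\top&R_{xr}^{N-}\Theta\end{bmatrix}\succ0 .$$ Then the data $(U_-,X)$ are informative for stabilization by state feedback. Moreover, $K=R_{ur}^{N-}\Theta(R_{xr}^{N-}\Theta)^{-1}$ satisfies $\Sigma_{(U_-,X)}^R\subseteq\Sigma_K$.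
   Context: Scalar setting with one instrumental signal. Let $N\ge1$. State data $x(0),\dots,x(N)\in\mathbb{R}$ and input data $u(0),\dots,u(N-1)\in\mathbb{R}$ are collected in $X=[x(0)\ \cdots\ x(N)]$, $X_+=[x(1)\ \cdots\ x(N)]$, $X_-=[x(0)\ \cdots\ x(N-1)]$, $U_-=[u(0)\ \cdots\ u(N-1)]$. An instrumental signal $R_-=[r(0)\ \cdots\ r(N-1)]\in\mathbb{R}^{1\times N}$ and bounds $c^l,c^u\in\mathbb{R}$ are given. The data are generated by a true system $(A_0,B_0)\in\mathbb{R}^2$, i.e. $X_+=A_0X_-+B_0U_-+E_-^0$ for some unknown noise $E_-^0\in\mathcal{E}_R:=\{E\in\mathbb{R}^{1\times N}\mid c^l\le\frac{1}{\sqrt N}ER_-^\top\le c^u\}$. The set of feasible systems is $$\Sigma_{(U_-,X)}^R:=\{(A,B)\in\mathbb{R}^2\mid\exists E_-\in\mathcal{E}_R:\ X_+=AX_-+BU_-+E_-\}.$$ Define $R_{xr}^{N+}=\frac1{\sqrt N}X_+R_-^\top$, $R_{xr}^{N-}=\frac1{\sqrt N}X_-R_-^\top$, $R_{ur}^{N-}=\frac1{\sqrt N}U_-R_-^\top$ (all scalars). A matrix is called stable if all its eigenvalues are in the open unit disk. For $K\in\mathbb{R}$, $\Sigma_K:=\{(A,B)\in\mathbb{R}^2\mid A+BK\text{ is stable}\}$. The data $(U_-,X)$ are informative for stabilization by state feedback if there exists $K$ with $\Sigma_{(U_-,X)}^R\subseteq\Sigma_K$. $\succ0$ means symmetric positive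 definite. *)

theory Defs
  imports Complex_Main "Jordan_Normal_Form.Char_Poly"
begin

definition mat11 :: "real \<Rightarrow> real mat" where
  "mat11 a = mat 1 1 (\<lambda>_. a)"

definition stable :: "real mat \<Rightarrow> bool" where
  "stable M \<longleftrightarrow> square_mat M \<and>
     (\<forall>k. eigenvalue (map_mat complex_of_real M) k \<longrightarrow> cmod k < 1)"

definition pos_def :: "real mat \<Rightarrow> bool" where
  "pos_def M \<longleftrightarrow> square_mat M \<and> transpose_mat M = M \<and>
     (\<forall>v \<in> carrier_vec (dim_row M). v \<noteq> 0\<^sub>v (dim_row M) \<longrightarrow> v \<bullet> (M *\<^sub>v v) > 0)"

text \<open>A signal is a function of time, of which only the samples in the window are used:
  \<open>samples s N f\<close> is the row \<open>[f(s) ... f(s + N - 1)]\<close>.  With state data \<open>x\<close> and input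
  data \<open>u\<close>, the rows \<open>X_-\<close>, \<open>X_+\<close>, \<open>U_-\<close> are \<open>samples 0 N x\<close>, \<open>samples 1 N x\<close>,
  \<open>samples 0 N u\<close>.\<close>

definition samples :: "nat \<Rightarrow> nat \<Rightarrow> (nat \<Rightarrow> real) \<Rightarrow> real mat" where
  "samples s N f = mat 1 N (\<lambda>(i, j). f (s + j))"

text \<open>The only entry of the \<open>1\<close> by \<open>1\<close> matrix \<open>Z R\<^sup>T / sqrt N\<close>, for rows \<open>Z\<close>, \<open>R\<close> of
  length \<open>N\<close>.\<close>

definition corr :: "nat \<Rightarrow> real mat \<Rightarrow> real mat \<Rightarrow> real" where
  "corr N Z R = 1 / sqrt (real N) * (Z * transpose_mat R) $$ (0, 0)"

definition noise_set :: "nat \<Rightarrow> real mat \<Rightarrow> real \<Rightarrow> real \<Rightarrow> real mat set" where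
  "noise_set N R cl cu = {E \<in> carrier_mat 1 N. cl \<le> corr N E R \<and> corr N E R \<le> cu}"

definition explains ::
    "nat \<Rightarrow> (nat \<Rightarrow> real) \<Rightarrow> (nat \<Rightarrow> real) \<Rightarrow> real \<times> real \<Rightarrow> real mat \<Rightarrow> bool" where
  "explains N u x = (\<lambda>(A, B) E.
     samples 1 N x = A \<cdot>\<^sub>m samples 0 N x + B \<cdot>\<^sub>m samples 0 N u + E)"

definition feasible_systems ::
    "nat \<Rightarrow> (nat \<Rightarrow> real) \<Rightarrow> real \<Rightarrow> real \<Rightarrow> (nat \<Rightarrow> real) \<Rightarrow> (nat \<Rightarrow> real) \<Rightarrow> (real \<times> real) set" where
  "feasible_systems N r cl cu u x =
     {S. \<exists>E \<in> noise_set N (samples 0 N r) cl cu. explains N u x S E}"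

definition stabilized_systems :: "real \<Rightarrow> (real \<times> real) set" where
  "stabilized_systems K = {(A, B). stable (mat11 (A + B * K))}"

definition informative_for_stabilization ::
    "nat \<Rightarrow> (nat \<Rightarrow> real) \<Rightarrow> real \<Rightarrow> real \<Rightarrow> (nat \<Rightarrow> real) \<Rightarrow> (nat \<Rightarrow> real) \<Rightarrow> bool" where
  "informative_for_stabilization N r cl cu u x \<longleftrightarrow>
     (\<exists>K. feasible_systems N r cl cu u x \<subseteq> stabilized_systems K)"

definition lmi_mat :: "real \<Rightarrow> real \<Rightarrow> real \<Rightarrow> real \<Rightarrow> real mat" where
  "lmi_mat Rp Rm c \<Theta> = four_block_mat
     (mat11 (Rm * \<Theta>))                                        (mat11 ((Rp - c) * \<Theta>))
     (transpose_mat (mat11 \<Theta>) * transpose_mat (mat11 (Rp - c))) (mat11 (Rm * \<Theta>))"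

end

theory Submission
  imports Defs
begin

text \<open>The noise bound constrains a system only through one scalar equation.  Correlating
  \<open>X_+ = A X_- + B U_- + E\<close> with the instrument turns it into \<open>R\<^sup>+ = A R\<^sup>- + B R\<^sup>u + e\<close> with
  \<open>c\<^sup>l \<le> e \<le> c\<^sup>u\<close> (lemma \<open>corr_linear\<close>).  The gain \<open>K = R\<^sup>u \<Theta> / (R\<^sup>- \<Theta>)\<close> is chosen so that
  the unknown \<open>A\<close> and \<open>B\<close> enter the closed loop only in the combination that this equation
  determines:
  \<open>A + B K = (A R\<^sup>- + B R\<^sup>u) \<Theta> / (R\<^sup>- \<Theta>) = (R\<^sup>+ - e) \<Theta> / (R\<^sup>- \<Theta>)\<close>.

  The two matrix inequalities say that this quotient lies strictly between \<open>-1\<close> and \<open>1\<close> at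
  the two extreme noise levels \<open>e = c\<^sup>l\<close> and \<open>e = c\<^sup>u\<close> (lemma \<open>lmi_mat_posD\<close>).  It is affine
  in \<open>e\<close>, hence lies strictly between \<open>-1\<close> and \<open>1\<close> for every admissible \<open>e\<close>, and a scalar
  system is stable exactly when its coefficient does.\<close>

lemma stable_mat11:
  assumes "\<bar>a\<bar> < 1"
  shows "stable (mat11 a)"
proof -
  have "k = complex_of_real a" if "eigenvalue (map_mat complex_of_real (mat11 a)) k" for k
  proof -
    from that obtain v where v: "v \<in> carrier_vec 1" "v \<noteq> 0\<^sub>v 1"
      and eq: "map_mat complex_of_real (mat11 a) *\<^sub>v v = k \<cdot>\<^sub>v v"
      by (auto simp: eigenvalue_def eigenvector_def mat11_def)
    have "v $ 0 \<noteq> 0"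
      using v by auto
    moreover have "complex_of_real a * v $ 0 = k * v $ 0"
      using arg_cong[OF eq, of "\<lambda>w. w $ 0"] v(1) by (simp add: mat11_def scalar_prod_def)
    ultimately show ?thesis
      by simp
  qed
  moreover have "square_mat (mat11 a)"
    by (simp add: mat11_def)
  ultimately show ?thesis
    unfolding stable_def using assms by (metis norm_of_real)
qed

text \<open>Testing the quadratic form on \<open>(1, 1)\<close> and \<open>(1, -1)\<close>, the eigenvectors of a symmetric
  \<open>2\<close> by \<open>2\<close> matrix with equal diagonal entries, yields the two bounds.\<close>

lemma lmi_mat_posD:
  assumes "pos_def (lmi_mat p m c \<theta>)"
  shows "\<bar>(p - c) * \<theta>\<bar> < m * \<theta>"
proof -
  let ?M = "lmi_mat p m c \<theta>"
  have dim: "dim_row ?M = 2" "dim_col ?M = 2"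
    by (simp_all add: lmi_mat_def mat11_def)
  have entries: "?M $$ (0, 0) = m * \<theta>" "?M $$ (0, 1) = (p - c) * \<theta>"
    "?M $$ (1, 0) = (p - c) * \<theta>" "?M $$ (1, 1) = m * \<theta>"
    by (simp_all add: lmi_mat_def mat11_def scalar_prod_def)
  have "0 < 2 * (m * \<theta>) + 2 * s * ((p - c) * \<theta>)" if s: "s = 1 \<or> s = - 1" for s :: real
  proof -
    define v where "v = vec 2 (\<lambda>i. if i = 0 then 1 else s)"
    have "v \<in> carrier_vec 2" "v \<noteq> 0\<^sub>v 2"
      by (auto simp: v_def dest: arg_cong[where f = "\<lambda>w. w $ 0"])
    then have "0 < v \<bullet> (?M *\<^sub>v v)"
      using assms dim by (auto simp: pos_def_def)
    also have "v \<bullet> (?M *\<^sub>v v) = m * \<theta> + 2 * s * ((p - c) * \<theta>) + s\<^sup>2 * (m * \<theta>)"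
    proof -
      have "v \<bullet> (?M *\<^sub>v v) = ?M $$ (0, 0) + s * ?M $$ (0, 1) + s * (?M $$ (1, 0) + s * ?M $$ (1, 1))"
        using dim by (simp add: v_def scalar_prod_def numeral_2_eq_2 mult.commute)
      then show ?thesis
        unfolding entries by (simp add: power2_eq_square algebra_simps)
    qed
    finally show ?thesis
      using s by (auto simp: algebra_simps)
  qed
  from this[of 1] this[of "-1"] show ?thesis
    by simp
qed

lemma corr_eq_sum:
  assumes "Z \<in> carrier_mat 1 N" "R \<in> carrier_mat 1 N"
  shows "corr N Z R = 1 / sqrt (real N) * (\<Sum>j<N. Z $$ (0, j) * R $$ (0, j))"
  using assms by (simp add: corr_def scalar_prod_def atLeast0LessThan)

lemma corr_linear:
  assumes "X \<in> carrier_mat 1 N" "U \<in> carrier_mat 1 N" "E \<in> carrier_mat 1 N"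
    "R \<in> carrier_mat 1 N"
  shows "corr N (a \<cdot>\<^sub>m X + b \<cdot>\<^sub>m U + E) R = a * corr N X R + b * corr N U R + corr N E R"
proof -
  have "a \<cdot>\<^sub>m X + b \<cdot>\<^sub>m U + E \<in> carrier_mat 1 N"
    using assms by simp
  then show ?thesis
    using assms
    by (simp add: corr_eq_sum sum.distrib sum_distrib_left distrib_right distrib_left
        mult.assoc mult.left_commute)
qed

lemma samples_carrier: "samples s N f \<in> carrier_mat 1 N"
  by (simp add: samples_def)

lemma abs_affine_less:
  fixes cl cu e p \<theta> d :: real
  assumes "cl \<le> e" "e \<le> cu" "\<bar>(p - cl) * \<theta>\<bar> < d" "\<bar>(p - cu) * \<theta>\<bar> < d"
  shows "\<bar>(p - e) * \<theta>\<bar> < d"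
proof (cases "\<theta> \<ge> 0")
  case True
  then have "(p - cu) * \<theta> \<le> (p - e) * \<theta>" "(p - e) * \<theta> \<le> (p - cl) * \<theta>"
    using assms by (auto intro!: mult_right_mono)
  then show ?thesis
    using assms by linarith
next
  case False
  then have "(p - cl) * \<theta> \<le> (p - e) * \<theta>" "(p - e) * \<theta> \<le> (p - cu) * \<theta>"
    using assms by (auto intro!: mult_right_mono_neg)
  then show ?thesis
    using assms by linarith
qed

theorem proposition10:
  fixes N :: nat and x u r :: "nat \<Rightarrow> real" and cl cu A0 B0 \<Theta> Rxr_plus Rxr_minus Rur_minus :: real
    and E0 :: "real mat"
  assumes N: "N \<ge> 1"
    and noise: "E0 \<in> noise_set N (samples 0 N r) cl cu"
    and true_system: "explains N u x (A0, B0) E0"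
    and Rxr_plus: "Rxr_plus = corr N (samples 1 N x) (samples 0 N r)"
    and Rxr_minus: "Rxr_minus = corr N (samples 0 N x) (samples 0 N r)"
    and Rur_minus: "Rur_minus = corr N (samples 0 N u) (samples 0 N r)"
    and sym: "mat11 (Rxr_minus * \<Theta>) = transpose_mat (mat11 (Rxr_minus * \<Theta>))"
    and lmi_lower: "pos_def (lmi_mat Rxr_plus Rxr_minus cl \<Theta>)"
    and lmi_upper: "pos_def (lmi_mat Rxr_plus Rxr_minus cu \<Theta>)"
  shows "informative_for_stabilization N r cl cu u x \<and>
    feasible_systems N r cl cu u x
      \<subseteq> stabilized_systems (Rur_minus * \<Theta> * inverse (Rxr_minus * \<Theta>))"
proof -
  let ?K = "Rur_minus * \<Theta> * inverse (Rxr_minus * \<Theta>)"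
  have lower: "\<bar>(Rxr_plus - cl) * \<Theta>\<bar> < Rxr_minus * \<Theta>"
    and upper: "\<bar>(Rxr_plus - cu) * \<Theta>\<bar> < Rxr_minus * \<Theta>"
    using lmi_mat_posD[OF lmi_lower] lmi_mat_posD[OF lmi_upper] .
  have pos: "Rxr_minus * \<Theta> > 0"
    using lower by linarith
  then have nonzero: "Rxr_minus \<noteq> 0" "\<Theta> \<noteq> 0"
    by auto
  have "stable (mat11 (A + B * ?K))"
    if feasible: "(A, B) \<in> feasible_systems N r cl cu u x" for A B
  proof -
    obtain E where E: "E \<in> carrier_mat 1 N" "cl \<le> corr N E (samples 0 N r)"
        "corr N E (samples 0 N r) \<le> cu"
      and data: "samples 1 N x = A \<cdot>\<^sub>m samples 0 N x + B \<cdot>\<^sub>m samples 0 N u + E"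
      using feasible by (auto simp: feasible_systems_def noise_set_def explains_def)
    define e where "e = corr N E (samples 0 N r)"
    have "Rxr_plus = A * Rxr_minus + B * Rur_minus + e"
      unfolding Rxr_plus Rxr_minus Rur_minus e_def data
      by (intro corr_linear samples_carrier E(1))
    then have "A + B * ?K = (Rxr_plus - e) * \<Theta> / (Rxr_minus * \<Theta>)"
      using nonzero by (simp add: field_simps)
    moreover have "\<bar>(Rxr_plus - e) * \<Theta>\<bar> < Rxr_minus * \<Theta>"
      using abs_affine_less[OF E(2,3) lower upper] unfolding e_def .
    ultimately have "\<bar>A + B * ?K\<bar> < 1"
      using pos by (simp only: abs_divide) simp
    then show ?thesis
      by (rule stable_mat11)
  qed
  then have "feasible_systems N r cl cu u x \<subseteq> stabilized_systems ?K"
    by (auto simp: stabilized_systems_def)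
  then show ?thesis
    unfolding informative_for_stabilization_def by blast
qed

end
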